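(* Let $\theta\in\mathbb R\setminus\{0\}$ and let $(X_k,Y_k)_{k=1}^n$ be an i.i.d. sample of $[X,Y]\in\mathcal D$. Then, as $n\to\infty$, the empirical lcf and codifferences are asymptotically Gaussian: $$\sqrt n\big(\widehat l^{\,\theta}(X)-l^\theta(X)\big)\xrightarrow{d}\mathcal N\left(0,\frac{4}{\theta^4}\frac{C_{X,X}(\theta)}{\varphi_X(\theta)^2}\right),$$ $$\sqrt n\big(\widehat s^{\,\theta}(X,Y)-s^\theta(X,Y)\big)\xrightarrow{d}\mathcal N\left(0,\frac{1}{4\theta^4}\left(\frac{C_{X+Y,X+Y}(\theta)}{\varphi_{X+Y}(\theta)^2}+\frac{C_{X-Y,X-Y}(\theta)}{\varphi_{X-Y}(\theta)^2}-\frac{2C_{X+Y,X-Y}(\theta)}{\varphi_{X+Y}(\theta)\varphi_{X-Y}(\theta)}\right)\right),$$ $$\sqrt n\big(\widehat c_\pm^{\,\theta}(X,Y)-c_\pm^\theta(X,Y)\big)\xrightarrow{d}\mathcal N\left(0,\frac{1}{\theta^4}\left(\frac{C_{X,X}(\theta)}{\varphi_X(\theta)^2}+\frac{C_{Y,Y}(\theta)}{\varphi_Y(\theta)^2}+\frac{C_{X\mp Y,X\mp Y}(\theta)}{\varphi_{X\mp Y}(\theta)^2}+\frac{2C_{X,Y}(\theta)}{\varphi_X(\theta)\varphi_Y(\theta)}-\frac{2C_{X,X\mp Y}(\theta)}{\varphi_X(\theta)\varphi_{X\mp Y}(\theta)}-\frac{2C_{Y,X\mp Y}(\theta)}{\varphi_Y(\theta)\varphi_{X\mp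 Y}(\theta)}\right)\right).$$
   Context: $\mathcal D$ denotes the class of (one- or multi-dimensional) random variables with strictly positive-definite Lebesgue density, together with the limiting case of an atom at $0$ (null components such as $X-X=0$ allowed); characteristic functions of members of $\mathcal D$ are real-valued and strictly positive. $\varphi_A(\theta)=\mathbb E[e^{i\theta A}]$ and, for linear combinations $A,B$ of $X,Y$, $C_{A,B}(\theta):=\frac{\varphi_{A+B}(\theta)+\varphi_{A-B}(\theta)}{2}-\varphi_A(\theta)\varphi_B(\theta)$. Define $l^\theta(A):=-\frac{2}{\theta^2}\ln\varphi_A(\theta)$, $s^\theta(X,Y):=\frac14\big(l^\theta(X+Y)-l^\theta(X-Y)\big)$, $c_\pm^\theta(X,Y):=\pm\frac12\big(l^\theta(X)+l^\theta(Y)-l^\theta(X\mp Y)\big)$. Empirical versions: $\widehat\varphi_A(\theta):=\frac1n\sum_{k=1}^n e^{i\theta A_k}$, where $A_k$ is the corresponding linear combination of $X_k,Y_k$; $\widehat l^{\,\theta}(A):=-\frac{2}{\theta^2}\ln(\mathrm{Re}\,\widehat\varphi_A(\theta))$ (formally $+\infty$ when $\mathrm{Re}\,\widehat\varphi_A(\theta)\le0$, an event of probability tending to $0$, on which $\widehat s^{\,\theta},\widehat c_\pm^{\,\theta}$ may be assigned arbitrary values); $\widehat s^{\,\theta}(X,Y):=\frac14\big(\widehat l^{\,\theta}(X+Y)-\widehat l^{\,\theta}(X-Y)\big)$; $\widehat c_\pm^{\,\theta}(X,Y):=\pm\frac12\big(\widehat l^{\,\theta}(X)+\widehat l^{\,\theta}(Y)-\widehat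 l^{\,\theta}(X\mp Y)\big)$. $\mathcal N(0,0)$ is read as $\delta_0$. *)

theory Defs
  imports "HOL-Probability.Probability"
begin

definition strictly_pos_def :: "('a::real_vector \<Rightarrow> real) \<Rightarrow> bool" where
  "strictly_pos_def f \<longleftrightarrow>
     (\<forall>S (c :: 'a \<Rightarrow> complex). finite S \<and> (\<exists>x\<in>S. c x \<noteq> 0) \<longrightarrow>
        (let q = (\<Sum>x\<in>S. \<Sum>y\<in>S. c x * cnj (c y) * complex_of_real (f (x - y)))
         in q \<in> \<real> \<and> 0 < Re q))"

(* Strict positive definiteness in the sense of quadratic forms does not by itself exclude zeros
   of the characteristic function (the Fejer density has a compactly supported one). Its strict
   positivity, which is characteristic of the class, is therefore a separate clause. *)
definition strictly_pd_law :: "'a::euclidean_space measure \<Rightarrow> bool" where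
  "strictly_pd_law \<nu> \<longleftrightarrow>
     prob_space \<nu> \<and>
     (\<exists>p \<in> borel_measurable lborel. (\<forall>x. 0 \<le> p x) \<and> strictly_pos_def p \<and>
        \<nu> = density lborel (\<lambda>x. ennreal (p x))) \<and>
     (\<forall>t. (CLINT x|\<nu>. iexp (t \<bullet> x)) \<in> \<real> \<and> 0 < Re (CLINT x|\<nu>. iexp (t \<bullet> x)))"

(* The class of laws closed up under null components: a linear T that is not injective gives a law
   with a density of this kind on a proper subspace and an atom at 0 in the complementary
   directions (such as X - X = 0); T = 0 gives the atom at 0, and T = id the laws with a density. *)
definition class_D :: "'a::euclidean_space measure \<Rightarrow> bool" where
  "class_D \<mu> \<longleftrightarrow>
     (\<exists>\<nu> (T :: 'a \<Rightarrow> 'a). strictly_pd_law \<nu> \<and> linear T \<and> \<mu> = distr \<nu> borel T)"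

(* Characteristic functions of linear combinations of components of members of the class are
   real-valued, so taking the real part only changes the type. *)
definition cf :: "'a measure \<Rightarrow> real \<Rightarrow> ('a \<Rightarrow> real) \<Rightarrow> real" where
  "cf M \<theta> A = Re (char (distr M borel A) \<theta>)"

definition C_cov :: "'a measure \<Rightarrow> real \<Rightarrow> ('a \<Rightarrow> real) \<Rightarrow> ('a \<Rightarrow> real) \<Rightarrow> real" where
  "C_cov M \<theta> A B =
     (cf M \<theta> (\<lambda>\<omega>. A \<omega> + B \<omega>) + cf M \<theta> (\<lambda>\<omega>. A \<omega> - B \<omega>)) / 2 - cf M \<theta> A * cf M \<theta> B"

definition lcf :: "'a measure \<Rightarrow> real \<Rightarrow> ('a \<Rightarrow> real) \<Rightarrow> real" where
  "lcf M \<theta> A = - (2 / \<theta>\<^sup>2) * ln (cf M \<theta> A)"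

definition codiff_s :: "'a measure \<Rightarrow> real \<Rightarrow> ('a \<Rightarrow> real) \<Rightarrow> ('a \<Rightarrow> real) \<Rightarrow> real" where
  "codiff_s M \<theta> X Y = (lcf M \<theta> (\<lambda>\<omega>. X \<omega> + Y \<omega>) - lcf M \<theta> (\<lambda>\<omega>. X \<omega> - Y \<omega>)) / 4"

(* The sign \<sigma> is 1 or -1 and selects the upper or the lower version; the argument with sign
   "minus-plus" is then X - \<sigma> Y. *)
definition codiff_c :: "'a measure \<Rightarrow> real \<Rightarrow> real \<Rightarrow> ('a \<Rightarrow> real) \<Rightarrow> ('a \<Rightarrow> real) \<Rightarrow> real" where
  "codiff_c M \<sigma> \<theta> X Y =
     \<sigma> / 2 * (lcf M \<theta> X + lcf M \<theta> Y - lcf M \<theta> (\<lambda>\<omega>. X \<omega> - \<sigma> * Y \<omega>))"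

(* The empirical quantities are functions of the data sequences a, x, y :: nat \<Rightarrow> real, the sample
   of size n being the entries with index below n. *)
definition emp_cf :: "real \<Rightarrow> nat \<Rightarrow> (nat \<Rightarrow> real) \<Rightarrow> complex" where
  "emp_cf \<theta> n a = (1 / of_nat n) * (\<Sum>k<n. iexp (\<theta> * a k))"

definition emp_lcf :: "real \<Rightarrow> nat \<Rightarrow> (nat \<Rightarrow> real) \<Rightarrow> ereal" where
  "emp_lcf \<theta> n a =
     (if 0 < Re (emp_cf \<theta> n a) then ereal (- (2 / \<theta>\<^sup>2) * ln (Re (emp_cf \<theta> n a))) else \<infinity>)"

definition emp_codiff_s :: "real \<Rightarrow> nat \<Rightarrow> (nat \<Rightarrow> real) \<Rightarrow> (nat \<Rightarrow> real) \<Rightarrow> ereal" where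
  "emp_codiff_s \<theta> n x y =
     (emp_lcf \<theta> n (\<lambda>k. x k + y k) - emp_lcf \<theta> n (\<lambda>k. x k - y k)) / 4"

definition emp_codiff_c :: "real \<Rightarrow> real \<Rightarrow> nat \<Rightarrow> (nat \<Rightarrow> real) \<Rightarrow> (nat \<Rightarrow> real) \<Rightarrow> ereal" where
  "emp_codiff_c \<sigma> \<theta> n x y =
     ereal (\<sigma> / 2) * (emp_lcf \<theta> n x + emp_lcf \<theta> n y - emp_lcf \<theta> n (\<lambda>k. x k - \<sigma> * y k))"

(* Second parameter of the normal law is the variance v \<ge> 0. *)
definition gaussian :: "real \<Rightarrow> real \<Rightarrow> real measure" where
  "gaussian m v =
     (if v = 0 then return borel m
      else density lborel (\<lambda>x. ennreal (normal_density m (sqrt v) x)))"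

(* Convergence in distribution of extended real random variables to a law on the reals;
   for real-valued variables this is weak_conv_m of their laws. *)
definition conv_in_dist_ereal :: "'a measure \<Rightarrow> (nat \<Rightarrow> 'a \<Rightarrow> ereal) \<Rightarrow> real measure \<Rightarrow> bool" where
  "conv_in_dist_ereal M Z L \<longleftrightarrow>
     weak_conv (\<lambda>n x. \<P>(\<omega> in M. Z n \<omega> \<le> ereal x)) (cdf L)"

end

theory Submission
  imports Defs "HOL-Real_Asymp.Real_Asymp"
begin

text \<open>All the quantities are combinations of logarithms of empirical means of the bounded i.i.d. vectors
  with entries \<open>cos (\<theta> (p \<bullet> (X\<^sub>k, Y\<^sub>k)))\<close>, for finitely many coefficient vectors \<open>p\<close>, and
  \<open>C\<close> is the covariance of such cosines. The limiting means, the values of the characteristic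
  function, are positive, so the logarithms can be linearized. The linear part is
  asymptotically normal by the central limit theorem. By Hoeffding's inequality the relative
  errors of the means are below \<open>d n\<^sup>-\<^sup>1\<^sup>/\<^sup>4\<close> with probability tending to 1, for every \<open>d > 0\<close>;
  the remainder, scaled by \<open>sqrt n\<close>, is then of order \<open>d\<^sup>2\<close> and vanishes in the limit by
  Slutsky's lemma.\<close>

section \<open>Slutsky's lemma for extended real variables\<close>

lemma exists_continuity_point:
  fixes F :: "real \<Rightarrow> real"
  assumes "mono F" "a < b"
  obtains y where "a < y" "y < b" "isCont F y"
  using open_minus_countable[OF mono_ctble_discont[OF assms(1)], of "{a<..<b}"] assms(2) by auto

text \<open>Off an event of small probability, \<open>Z n\<close> lies within \<open>e\<close> of
  \<open>W n\<close>, so \<open>Z n \<le> x\<close> is squeezed between events of the form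
  \<open>W n \<le> y\<close> with \<open>y\<close> slightly below and slightly above
  \<open>x\<close>. An infinite value of \<open>Z n\<close> violates the two-sided bound and hence
  is counted in that small event; no further treatment of infinite values is needed.\<close>

lemma (in prob_space) slutsky_ereal:
  fixes W :: "nat \<Rightarrow> 'a \<Rightarrow> real" and Z :: "nat \<Rightarrow> 'a \<Rightarrow> ereal"
  assumes L: "real_distribution L"
    and W: "\<And>n. random_variable borel (W n)"
    and Z: "\<And>n. random_variable borel (Z n)"
    and lim: "weak_conv_m (\<lambda>n. distr M borel (W n)) L"
    and close: "\<And>e. 0 < e \<Longrightarrow>
      (\<lambda>n. \<P>(\<omega> in M. \<not> (ereal (W n \<omega> - e) \<le> Z n \<omega> \<and> Z n \<omega> \<le> ereal (W n \<omega> + e)))) \<longlonglongrightarrow> 0"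
  shows "conv_in_dist_ereal M Z L"
  unfolding conv_in_dist_ereal_def weak_conv_def
proof (intro allI impI)
  note [measurable] = W Z
  interpret L: real_distribution L by (fact L)
  have mono: "mono (cdf L)" by (simp add: mono_def L.cdf_nondecreasing)
  have cdf_W: "cdf (distr M borel (W n)) y = \<P>(\<omega> in M. W n \<omega> \<le> y)" for n y
    by (simp add: cdf_def measure_distr vimage_def Int_def conj_commute)
  fix x assume cont: "isCont (cdf L) x"
  let ?bad = "\<lambda>e n. \<P>(\<omega> in M. \<not> (ereal (W n \<omega> - e) \<le> Z n \<omega> \<and> Z n \<omega> \<le> ereal (W n \<omega> + e)))"
  show "(\<lambda>n. \<P>(\<omega> in M. Z n \<omega> \<le> ereal x)) \<longlonglongrightarrow> cdf L x"
  proof (rule LIMSEQ_I, unfold eventually_sequentially[symmetric] real_norm_def)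
    fix r :: real assume r: "0 < r"
    \<comment> \<open>Half of \<open>r\<close> is spent on the variation of the limiting
      distribution function near \<open>x\<close>, the other half on the event where
      \<open>Z n\<close> and \<open>W n\<close> differ by more than \<open>e\<close>.\<close>
    from cont r obtain d where d: "d > 0" "\<And>y. \<bar>y - x\<bar> < d \<Longrightarrow> \<bar>cdf L y - cdf L x\<bar> < r / 2"
      unfolding continuous_at_eps_delta dist_real_def by (metis half_gt_zero)
    \<comment> \<open>The distribution functions of \<open>W n\<close> are known to converge only at
      continuity points of \<open>cdf L\<close>, so \<open>y1\<close> and \<open>y2\<close> must be
      such points. They exist because a monotone function has at most countably many
      discontinuities.\<close>
    obtain y1 where y1: "x - d < y1" "y1 < x" "isCont (cdf L) y1"
      by (rule exists_continuity_point[OF mono, of "x - d" x]) (use d in auto)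
    obtain y2 where y2: "x < y2" "y2 < x + d" "isCont (cdf L) y2"
      by (rule exists_continuity_point[OF mono, of x "x + d"]) (use d in auto)
    \<comment> \<open>This choice gives \<open>y1 + e \<le> x\<close> and
      \<open>x + e \<le> y2\<close>, exactly what the two inclusions of events below
      require.\<close>
    define e where "e = min (x - y1) (y2 - x)"
    have e: "e > 0" using y1 y2 by (simp add: e_def)
    have upper: "\<P>(\<omega> in M. Z n \<omega> \<le> ereal x) \<le> \<P>(\<omega> in M. W n \<omega> \<le> y2) + ?bad e n" for n
    proof -
      have "\<P>(\<omega> in M. Z n \<omega> \<le> ereal x) \<le> prob ({\<omega>\<in>space M. W n \<omega> \<le> y2} \<union>
        {\<omega>\<in>space M. \<not> (ereal (W n \<omega> - e) \<le> Z n \<omega> \<and> Z n \<omega> \<le> ereal (W n \<omega> + e))})"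
      proof (rule finite_measure_mono)
        show "{\<omega>\<in>space M. Z n \<omega> \<le> ereal x} \<subseteq> {\<omega>\<in>space M. W n \<omega> \<le> y2} \<union>
          {\<omega>\<in>space M. \<not> (ereal (W n \<omega> - e) \<le> Z n \<omega> \<and> Z n \<omega> \<le> ereal (W n \<omega> + e))}"
        proof
          fix \<omega> assume \<omega>: "\<omega> \<in> {\<omega>\<in>space M. Z n \<omega> \<le> ereal x}"
          have "W n \<omega> \<le> y2" if "ereal (W n \<omega> - e) \<le> Z n \<omega>"
          proof -
            from that \<omega> have "ereal (W n \<omega> - e) \<le> ereal x" using order_trans by blast
            then show ?thesis by (simp add: e_def)
          qed
          with \<omega> show "\<omega> \<in> {\<omega>\<in>space M. W n \<omega> \<le> y2} \<union>
            {\<omega>\<in>space M. \<not> (ereal (W n \<omega> - e) \<le> Z n \<omega> \<and> Z n \<omega> \<le> ereal (W n \<omega> + e))}"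
            by blast
        qed
      qed measurable
      also have "\<dots> \<le> \<P>(\<omega> in M. W n \<omega> \<le> y2) + ?bad e n"
        by (rule measure_Un_le) measurable
      finally show ?thesis .
    qed
    have lower: "\<P>(\<omega> in M. W n \<omega> \<le> y1) \<le> \<P>(\<omega> in M. Z n \<omega> \<le> ereal x) + ?bad e n" for n
    proof -
      have "\<P>(\<omega> in M. W n \<omega> \<le> y1) \<le> prob ({\<omega>\<in>space M. Z n \<omega> \<le> ereal x} \<union>
        {\<omega>\<in>space M. \<not> (ereal (W n \<omega> - e) \<le> Z n \<omega> \<and> Z n \<omega> \<le> ereal (W n \<omega> + e))})"
      proof (rule finite_measure_mono)
        show "{\<omega>\<in>space M. W n \<omega> \<le> y1} \<subseteq> {\<omega>\<in>space M. Z n \<omega> \<le> ereal x} \<union>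
          {\<omega>\<in>space M. \<not> (ereal (W n \<omega> - e) \<le> Z n \<omega> \<and> Z n \<omega> \<le> ereal (W n \<omega> + e))}"
        proof
          fix \<omega> assume \<omega>: "\<omega> \<in> {\<omega>\<in>space M. W n \<omega> \<le> y1}"
          then have "ereal (W n \<omega> + e) \<le> ereal x" by (auto simp: e_def)
          then have "Z n \<omega> \<le> ereal x" if "Z n \<omega> \<le> ereal (W n \<omega> + e)"
            using that order_trans by blast
          with \<omega> show "\<omega> \<in> {\<omega>\<in>space M. Z n \<omega> \<le> ereal x} \<union>
            {\<omega>\<in>space M. \<not> (ereal (W n \<omega> - e) \<le> Z n \<omega> \<and> Z n \<omega> \<le> ereal (W n \<omega> + e))}"
            by blast
        qed
      qed measurable
      also have "\<dots> \<le> \<P>(\<omega> in M. Z n \<omega> \<le> ereal x) + ?bad e n"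
        by (rule measure_Un_le) measurable
      finally show ?thesis .
    qed
    have lim': "(\<lambda>n. \<P>(\<omega> in M. W n \<omega> \<le> y)) \<longlonglongrightarrow> cdf L y" if "isCont (cdf L) y" for y
      using lim that unfolding weak_conv_m_def weak_conv_def cdf_W by blast
    have "\<forall>\<^sub>F n in sequentially. ?bad e n < r / 2"
      by (rule order_tendstoD(2)[OF close[OF e]]) (use r in simp)
    moreover have "\<forall>\<^sub>F n in sequentially. \<P>(\<omega> in M. W n \<omega> \<le> y2) < cdf L x + r / 2"
      by (rule order_tendstoD(2)[OF lim'[OF y2(3)]]) (use d(2)[of y2] y2 in linarith)
    moreover have "\<forall>\<^sub>F n in sequentially. \<P>(\<omega> in M. W n \<omega> \<le> y1) > cdf L x - r / 2"
      by (rule order_tendstoD(1)[OF lim'[OF y1(3)]]) (use d(2)[of y1] y1 in linarith)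
    ultimately show "\<forall>\<^sub>F n in sequentially. \<bar>\<P>(\<omega> in M. Z n \<omega> \<le> ereal x) - cdf L x\<bar> < r"
    proof eventually_elim
      case (elim n)
      then show ?case using upper[of n] lower[of n] by linarith
    qed
  qed
qed

text \<open>Takes the results on the real-valued versions of the codifferences, obtained in the
  extended real setting, back to ordinary weak convergence: both notions compare the same
  distribution functions.\<close>

lemma conv_in_dist_ereal_real:
  assumes [measurable]: "\<And>n. R n \<in> borel_measurable M"
  shows "conv_in_dist_ereal M (\<lambda>n \<omega>. ereal (R n \<omega>)) L \<longleftrightarrow> weak_conv_m (\<lambda>n. distr M borel (R n)) L"
  unfolding conv_in_dist_ereal_def weak_conv_m_def
  by (simp add: cdf_def measure_distr vimage_def Int_def conj_commute)

section \<open>Gaussian laws and the central limit theorem for bounded variables\<close>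

lemma real_distribution_gaussian: "v \<ge> 0 \<Longrightarrow> real_distribution (gaussian m v)"
  unfolding real_distribution_def real_distribution_axioms_def gaussian_def
  by (auto intro: prob_space_normal_density prob_space_return)

lemma gaussian_eq_distr_std_normal:
  assumes "v > 0"
  shows "gaussian 0 v = distr std_normal_distribution borel (\<lambda>x. sqrt v * x)"
proof -
  interpret prob_space std_normal_distribution
    by (rule prob_space_normal_density) simp
  have "distributed std_normal_distribution lborel (\<lambda>x. x) std_normal_density"
    by (simp add: distributed_def distr_id2 measurable_ident_sets cong: distr_cong)
  from normal_density_affine[OF this, of "sqrt v" 0] assms
  have "distributed std_normal_distribution lborel (\<lambda>x. sqrt v * x) (normal_density 0 (sqrt v))"
    by simp
  then have "distr std_normal_distribution lborel (\<lambda>x. sqrt v * x) = gaussian 0 v"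
    using assms by (simp add: distributed_distr_eq_density gaussian_def)
  \<comment> \<open>\<open>lborel\<close> and \<open>borel\<close> have the same measurable sets, so
    either may serve as the target of \<open>distr\<close>.\<close>
  then show ?thesis
    by (metis distr_cong sets_lborel)
qed

text \<open>The central limit theorem normalizes by the standard deviation and so needs
  \<open>v > 0\<close>. Here a null variance must be allowed as well, since null components give
  constant cosines; the limit is then the atom at 0. Boundedness provides the second
  moments.\<close>

lemma (in prob_space) clt_bounded:
  fixes V :: "nat \<Rightarrow> 'a \<Rightarrow> real"
  assumes indep: "indep_vars (\<lambda>_. borel) V UNIV"
    and ident: "\<And>k. distr M borel (V k) = distr M borel (V 0)"
    and bound: "\<And>k \<omega>. \<bar>V k \<omega>\<bar> \<le> K"
    and mean: "expectation (V 0) = 0"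
    and v: "v = expectation (\<lambda>\<omega>. (V 0 \<omega>)\<^sup>2)"
  shows "weak_conv_m (\<lambda>n. distr M borel (\<lambda>\<omega>. sqrt (real n) * ((\<Sum>k<n. V k \<omega>) / real n))) (gaussian 0 v)"
proof -
  have V[measurable]: "random_variable borel (V k)" for k
    using indep unfolding indep_vars_def by blast
  have transfer: "expectation (\<lambda>\<omega>. h (V k \<omega>)) = expectation (\<lambda>\<omega>. h (V 0 \<omega>))"
    if [measurable]: "h \<in> borel_measurable borel" for h :: "real \<Rightarrow> real" and k
  proof -
    have "expectation (\<lambda>\<omega>. h (V k \<omega>)) = integral\<^sup>L (distr M borel (V k)) h"
      by (rule integral_distr[symmetric]) measurable
    also have "\<dots> = integral\<^sup>L (distr M borel (V 0)) h" by (subst ident) simp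
    also have "\<dots> = expectation (\<lambda>\<omega>. h (V 0 \<omega>))" by (rule integral_distr) measurable
    finally show ?thesis .
  qed
  have mean': "expectation (V k) = 0" for k using transfer[of "\<lambda>x. x" k] mean by simp
  have sq: "integrable M (\<lambda>\<omega>. (V k \<omega>)\<^sup>2)" for k
  proof (rule integrable_const_bound[of _ "K\<^sup>2"])
    show "AE \<omega> in M. norm ((V k \<omega>)\<^sup>2) \<le> K\<^sup>2"
      using bound by (auto simp: abs_le_square_iff[symmetric] intro: order_trans[OF _ abs_ge_self])
  qed measurable
  have v0: "v \<ge> 0" unfolding v by (intro integral_nonneg_AE) simp
  show ?thesis
  proof (cases "v = 0")
    case True
    \<comment> \<open>A null second moment forces each \<open>V k\<close> to vanish almost surely.
      Countably many null sets can be discarded together, and every scaled mean then has the law of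
      the constant 0.\<close>
    have "AE \<omega> in M. V k \<omega> = 0" for k
      using integral_nonneg_eq_0_iff_AE[OF sq[of k]] transfer[of "\<lambda>x. x\<^sup>2" k] True v by simp
    then have AE: "AE \<omega> in M. \<forall>k. V k \<omega> = 0" by (simp add: AE_all_countable)
    have "distr M borel (\<lambda>\<omega>. sqrt (real n) * ((\<Sum>k<n. V k \<omega>) / real n)) = distr M borel (\<lambda>\<omega>. 0)" for n
      by (rule distr_cong_AE) (use AE in \<open>auto elim!: eventually_mono\<close>)
    moreover have "distr M borel (\<lambda>\<omega>. 0) = return borel (0::real)"
      by (rule distr_const) simp
    ultimately show ?thesis
      using True by (simp add: gaussian_def weak_conv_m_def weak_conv_def)
  next
    case False
    with v0 have v1: "v > 0" by simp
    have "weak_conv_m (\<lambda>n. distr M borel (\<lambda>\<omega>. (\<Sum>k<n. V k \<omega>) / sqrt (n * (sqrt v)\<^sup>2))) std_normal_distribution"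
    proof (rule central_limit_theorem_zero_mean[OF indep mean'])
      show "variance (V n) = (sqrt v)\<^sup>2" for n
        using mean' transfer[of "\<lambda>x. x\<^sup>2" n] v v1 by simp
    qed (use v1 ident sq in auto)
    then have std: "weak_conv_m (\<lambda>n. distr M borel (\<lambda>\<omega>. (\<Sum>k<n. V k \<omega>) / sqrt (n * v))) std_normal_distribution"
      using v1 by simp
    have cdf_scale: "cdf (distr N borel (\<lambda>x. sqrt v * f x)) x = cdf (distr N borel f) (x / sqrt v)"
      if [measurable]: "f \<in> borel_measurable N" for N :: "'x measure" and f x
      using v1 by (simp add: cdf_def measure_distr vimage_def field_simps)
    \<comment> \<open>For \<open>n = 0\<close> both sides are 0, as division by 0 yields 0.\<close>
    have scaled: "(\<lambda>\<omega>. sqrt (real n) * ((\<Sum>k<n. V k \<omega>) / real n)) =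
      (\<lambda>\<omega>. sqrt v * ((\<Sum>k<n. V k \<omega>) / sqrt (n * v)))" for n
      using v1 by (cases "n = 0") (auto simp: fun_eq_iff real_sqrt_mult real_div_sqrt field_simps
          simp flip: power2_eq_square)
    have gauss: "cdf (gaussian 0 v) x = cdf std_normal_distribution (x / sqrt v)" for x
      unfolding gaussian_eq_distr_std_normal[OF v1]
      by (subst cdf_scale) (simp_all add: distr_id2)
    show ?thesis
      unfolding weak_conv_m_def weak_conv_def
    proof (intro allI impI)
      fix x assume cont: "isCont (cdf (gaussian 0 v)) x"
      \<comment> \<open>Continuity of the limit at \<open>x\<close> has to be carried over to the
        standard normal distribution function at \<open>x / sqrt v\<close>, where the convergence is
        known.\<close>
      have "cdf std_normal_distribution = (\<lambda>y. cdf (gaussian 0 v) (sqrt v * y))"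
        using v1 by (simp add: gauss fun_eq_iff)
      moreover have "isCont (\<lambda>y. cdf (gaussian 0 v) (sqrt v * y)) (x / sqrt v)"
        by (rule isCont_o2[where g = "cdf (gaussian 0 v)"]) (use v1 cont in auto)
      ultimately have "isCont (cdf std_normal_distribution) (x / sqrt v)" by simp
      with std show "(\<lambda>n. cdf (distr M borel (\<lambda>\<omega>. sqrt (real n) * ((\<Sum>k<n. V k \<omega>) / real n))) x)
          \<longlonglongrightarrow> cdf (gaussian 0 v) x"
        unfolding scaled weak_conv_m_def weak_conv_def gauss by (subst cdf_scale) auto
    qed
  qed
qed


section \<open>The delta method for logarithms of empirical means\<close>

lemma sum_ln_linearization:
  fixes c m \<mu> :: "'j \<Rightarrow> real"
  assumes "\<And>j. j \<in> J \<Longrightarrow> 0 < \<mu> j" "\<And>j. j \<in> J \<Longrightarrow> \<bar>m j / \<mu> j - 1\<bar> \<le> r" "r \<le> 1 / 2"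
    and "\<And>j. j \<in> J \<Longrightarrow> 0 < m j"
  shows "\<bar>(\<Sum>j\<in>J. c j * (ln (m j) - ln (\<mu> j))) - (\<Sum>j\<in>J. c j * (m j / \<mu> j - 1))\<bar>
    \<le> 2 * r\<^sup>2 * (\<Sum>j\<in>J. \<bar>c j\<bar>)"
proof -
  have "\<bar>(\<Sum>j\<in>J. c j * (ln (m j) - ln (\<mu> j))) - (\<Sum>j\<in>J. c j * (m j / \<mu> j - 1))\<bar> =
      \<bar>\<Sum>j\<in>J. c j * (ln (m j / \<mu> j) - (m j / \<mu> j - 1))\<bar>"
    unfolding sum_subtractf[symmetric]
    by (intro arg_cong[where f = abs] sum.cong refl)
       (use assms in \<open>force simp: ln_div algebra_simps dest: less_imp_neq\<close>)
  also have "\<dots> \<le> (\<Sum>j\<in>J. \<bar>c j * (ln (m j / \<mu> j) - (m j / \<mu> j - 1))\<bar>)"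
    by (rule sum_abs)
  also have "\<dots> \<le> (\<Sum>j\<in>J. \<bar>c j\<bar> * (2 * r\<^sup>2))"
  proof (rule sum_mono)
    fix j assume j: "j \<in> J"
    \<comment> \<open>The second-order bound \<open>2 * x\<^sup>2\<close> for the error of
      \<open>ln (1 + x)\<close> against \<open>x\<close> holds for \<open>x\<close> of modulus at
      most 1/2; this is where \<open>r \<le> 1 / 2\<close> enters.\<close>
    have "\<bar>ln (1 + (m j / \<mu> j - 1)) - (m j / \<mu> j - 1)\<bar> \<le> 2 * (m j / \<mu> j - 1)\<^sup>2"
      using assms(2)[OF j] assms(3) by (intro abs_ln_one_plus_x_minus_x_bound) linarith
    also have "\<dots> \<le> 2 * r\<^sup>2"
      using power_mono[OF assms(2)[OF j], of 2] by simp
    finally show "\<bar>c j * (ln (m j / \<mu> j) - (m j / \<mu> j - 1))\<bar> \<le> \<bar>c j\<bar> * (2 * r\<^sup>2)"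
      by (simp add: abs_mult mult_left_mono)
  qed
  finally show ?thesis by (simp add: sum_distrib_left mult_ac)
qed

text \<open>\<open>Z n\<close> is prescribed only where all the empirical means are positive, which
  leaves room for infinite or arbitrary values elsewhere. Such points need no separate estimate: for
  large \<open>n\<close>, a nonpositive mean is already a large relative deviation, which
  Hoeffding's inequality makes improbable. The double sum is the variance of the linearized
  summand.\<close>

lemma (in prob_space) delta_method_ln:
  fixes D :: "nat \<Rightarrow> 'a \<Rightarrow> 'c::topological_space" and U :: "'j \<Rightarrow> 'c \<Rightarrow> real"
    and c \<mu> :: "'j \<Rightarrow> real" and Z :: "nat \<Rightarrow> 'a \<Rightarrow> ereal"
  assumes J: "finite J"
    and indep: "indep_vars (\<lambda>_. borel) D UNIV"
    and ident: "\<And>k. distr M borel (D k) = distr M borel (D 0)"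
    and U: "\<And>j. j \<in> J \<Longrightarrow> U j \<in> borel_measurable borel"
    and bound: "\<And>j z. j \<in> J \<Longrightarrow> \<bar>U j z\<bar> \<le> 1"
    and \<mu>: "\<And>j. j \<in> J \<Longrightarrow> \<mu> j = expectation (\<lambda>\<omega>. U j (D 0 \<omega>))"
    and \<mu>_pos: "\<And>j. j \<in> J \<Longrightarrow> 0 < \<mu> j"
    and Z: "\<And>n. random_variable borel (Z n)"
    and Z_eq: "\<And>n \<omega>. \<omega> \<in> space M \<Longrightarrow> 0 < n \<Longrightarrow>
      (\<And>j. j \<in> J \<Longrightarrow> 0 < (\<Sum>k<n. U j (D k \<omega>)) / real n) \<Longrightarrow>
      Z n \<omega> = ereal (sqrt (real n) *
        (\<Sum>j\<in>J. c j * (ln ((\<Sum>k<n. U j (D k \<omega>)) / real n) - ln (\<mu> j))))"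
  shows "conv_in_dist_ereal M Z (gaussian 0 (\<Sum>i\<in>J. \<Sum>j\<in>J.
    c i * c j * (expectation (\<lambda>\<omega>. U i (D 0 \<omega>) * U j (D 0 \<omega>)) - \<mu> i * \<mu> j) / (\<mu> i * \<mu> j)))"
    (is "conv_in_dist_ereal M Z (gaussian 0 ?v)")
proof -
  have D[measurable]: "random_variable borel (D k)" for k
    using indep unfolding indep_vars_def by blast
  have UD[measurable]: "random_variable borel (\<lambda>\<omega>. U j (D k \<omega>))" if "j \<in> J" for j k
    using measurable_compose[OF D U[OF that]] .
  have int_U: "integrable M (\<lambda>\<omega>. U j (D k \<omega>))" if "j \<in> J" for j k
    using that bound by (intro integrable_const_bound[of _ 1]) auto
  have int_UU: "integrable M (\<lambda>\<omega>. U i (D k \<omega>) * U j (D k \<omega>))" if "i \<in> J" "j \<in> J" for i j k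
    using that bound
    by (intro integrable_const_bound[of _ 1]) (auto simp: abs_mult intro!: mult_le_one)
  define m where "m j n \<omega> = (\<Sum>k<n. U j (D k \<omega>)) / real n" for j n \<omega>
  \<comment> \<open>The derivative of \<open>ln\<close> at \<open>\<mu> j\<close> is
    \<open>1 / \<mu> j\<close>, so \<open>g\<close> is the contribution of one observation to the
    linear part, and \<open>W\<close> is the scaled mean of these centred contributions.\<close>
  define g where "g z = (\<Sum>j\<in>J. c j * (U j z / \<mu> j - 1))" for z
  define W where "W n \<omega> = sqrt (real n) * ((\<Sum>k<n. g (D k \<omega>)) / real n)" for n \<omega>
  have g[measurable]: "g \<in> borel_measurable borel"
    unfolding g_def[abs_def] using U by (intro borel_measurable_sum) auto
  have g_D[measurable]: "random_variable borel (\<lambda>\<omega>. g (D k \<omega>))" for k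
    by (rule measurable_compose[OF D g])
  have ident': "distr M borel (\<lambda>\<omega>. h (D k \<omega>)) = distr M borel (\<lambda>\<omega>. h (D 0 \<omega>))"
    if h: "h \<in> borel_measurable borel" for h :: "'c \<Rightarrow> real" and k
    using distr_distr[OF h D, of k] distr_distr[OF h D, of 0] ident[of k] by (simp add: comp_def)
  have mean: "expectation (\<lambda>\<omega>. g (D 0 \<omega>)) = 0"
    unfolding g_def using int_U \<mu>[symmetric] \<mu>_pos
    by (subst Bochner_Integration.integral_sum) (auto simp: prob_space less_imp_neq[symmetric])
  have cross: "expectation (\<lambda>\<omega>. (c i * (U i (D 0 \<omega>) / \<mu> i - 1)) * (c j * (U j (D 0 \<omega>) / \<mu> j - 1)))
      = c i * c j * (expectation (\<lambda>\<omega>. U i (D 0 \<omega>) * U j (D 0 \<omega>)) - \<mu> i * \<mu> j) / (\<mu> i * \<mu> j)"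
    and int_cross: "integrable M (\<lambda>\<omega>. (c i * (U i (D 0 \<omega>) / \<mu> i - 1)) * (c j * (U j (D 0 \<omega>) / \<mu> j - 1)))"
    if ij: "i \<in> J" "j \<in> J" for i j
  proof -
    \<comment> \<open>In expectation, each of the two mixed terms of the last factor contributes
      minus \<open>\<mu> i * \<mu> j\<close>; together with the constant term this leaves the
      covariance of \<open>U i\<close> and \<open>U j\<close>.\<close>
    have eq: "(c i * (U i z / \<mu> i - 1)) * (c j * (U j z / \<mu> j - 1)) = c i * c j / (\<mu> i * \<mu> j) *
      (U i z * U j z - \<mu> i * U j z - \<mu> j * U i z + \<mu> i * \<mu> j)" for z
      using \<mu>_pos[OF ij(1)] \<mu>_pos[OF ij(2)] by (simp add: field_simps)
    show "integrable M (\<lambda>\<omega>. (c i * (U i (D 0 \<omega>) / \<mu> i - 1)) * (c j * (U j (D 0 \<omega>) / \<mu> j - 1)))"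
      unfolding eq using ij int_U int_UU by auto
    show "expectation (\<lambda>\<omega>. (c i * (U i (D 0 \<omega>) / \<mu> i - 1)) * (c j * (U j (D 0 \<omega>) / \<mu> j - 1)))
      = c i * c j * (expectation (\<lambda>\<omega>. U i (D 0 \<omega>) * U j (D 0 \<omega>)) - \<mu> i * \<mu> j) / (\<mu> i * \<mu> j)"
      unfolding eq using ij int_U int_UU by (simp add: prob_space \<mu>[symmetric])
  qed
  have var: "?v = expectation (\<lambda>\<omega>. (g (D 0 \<omega>))\<^sup>2)"
    unfolding g_def power2_eq_square sum_product
    using int_cross by (simp add: Bochner_Integration.integral_sum cross)
  have v0: "?v \<ge> 0" unfolding var by (intro integral_nonneg_AE) simp
  have lim: "weak_conv_m (\<lambda>n. distr M borel (W n)) (gaussian 0 ?v)"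
    unfolding W_def[abs_def]
  proof (rule clt_bounded[where V = \<open>\<lambda>k \<omega>. g (D k \<omega>)\<close>, OF _ _ _ mean var])
    show "indep_vars (\<lambda>_. borel) (\<lambda>k \<omega>. g (D k \<omega>)) UNIV"
      using indep by (rule indep_vars_compose2) simp
    show "distr M borel (\<lambda>\<omega>. g (D k \<omega>)) = distr M borel (\<lambda>\<omega>. g (D 0 \<omega>))" for k
      by (rule ident') simp
    show "\<bar>g (D k \<omega>)\<bar> \<le> (\<Sum>j\<in>J. \<bar>c j\<bar> * (1 / \<mu> j + 1))" for k \<omega>
      unfolding g_def
    proof (rule order_trans[OF sum_abs sum_mono])
      fix j assume j: "j \<in> J"
      have "\<bar>U j (D k \<omega>) / \<mu> j\<bar> \<le> 1 / \<mu> j"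
        using bound[OF j, of "D k \<omega>"] \<mu>_pos[OF j] by (simp add: divide_right_mono)
      then have "\<bar>U j (D k \<omega>) / \<mu> j - 1\<bar> \<le> 1 / \<mu> j + 1" by linarith
      then show "\<bar>c j * (U j (D k \<omega>) / \<mu> j - 1)\<bar> \<le> \<bar>c j\<bar> * (1 / \<mu> j + 1)"
        by (simp add: abs_mult mult_left_mono)
    qed
  qed
  have W_eq: "W n \<omega> = sqrt (real n) * (\<Sum>j\<in>J. c j * (m j n \<omega> / \<mu> j - 1))" if "n > 0" for n \<omega>
  proof -
    have "(\<Sum>k<n. g (D k \<omega>)) = (\<Sum>j\<in>J. \<Sum>k<n. c j * (U j (D k \<omega>) / \<mu> j - 1))"
      unfolding g_def by (rule sum.swap)
    also have "\<dots> = (\<Sum>j\<in>J. real n * (c j * (m j n \<omega> / \<mu> j - 1)))"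
      using that by (intro sum.cong refl)
        (simp add: m_def sum_distrib_left[symmetric] sum_subtractf sum_divide_distrib[symmetric] field_simps)
    finally show ?thesis
      using that by (simp add: W_def sum_distrib_left[symmetric])
  qed
  show ?thesis
  proof (rule slutsky_ereal[OF real_distribution_gaussian[OF v0] _ Z lim])
    show [measurable]: "random_variable borel (W n)" for n unfolding W_def[abs_def] by measurable
    note [measurable] = Z
    fix e :: real assume e: "0 < e"
    define A where "A = (\<Sum>j\<in>J. \<bar>c j\<bar>)"
    have A: "A \<ge> 0" unfolding A_def by (simp add: sum_nonneg)
    \<comment> \<open>Chosen so that \<open>2 * d\<^sup>2 * A \<le> e\<close>. The denominator has
      \<open>1 + A\<close> in place of \<open>A\<close> because \<open>A\<close> is 0 when all
      coefficients vanish.\<close>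
    define d where "d = sqrt (e / (2 * (1 + A)))"
    have d: "d > 0" using e A by (simp add: d_def)
    \<comment> \<open>The rate of order \<open>n\<close> to the power -1/4 serves two purposes:
      \<open>sqrt n * (r n)\<^sup>2\<close> equals the constant \<open>d\<^sup>2\<close>, which
      controls the remainder, while \<open>n * (r n)\<^sup>2\<close> grows like
      \<open>sqrt n\<close>, which makes the exponential bound tend to 0.\<close>
    define r where "r n = d / sqrt (sqrt (real n))" for n
    have r0: "r n \<ge> 0" for n using d by (simp add: r_def)
    have r2: "sqrt (real n) * (2 * (r n)\<^sup>2 * A) \<le> e" if "n > 0" for n
    proof -
      have "sqrt (real n) * (2 * (r n)\<^sup>2 * A) = 2 * d\<^sup>2 * A"
        using that by (simp add: r_def power_divide)
      also have "\<dots> = e * (A / (1 + A))"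
        using e A by (simp add: d_def field_simps)
      also have "\<dots> \<le> e * 1" using e A by (intro mult_left_mono) (auto simp: field_simps)
      finally show ?thesis by simp
    qed
    let ?bad = "\<lambda>n. {\<omega>\<in>space M. \<not> (ereal (W n \<omega> - e) \<le> Z n \<omega> \<and> Z n \<omega> \<le> ereal (W n \<omega> + e))}"
    have m_meas: "random_variable borel (m j n)" if "j \<in> J" for j n
      unfolding m_def[abs_def] using that by measurable
    \<comment> \<open>If all relative errors are below \<open>r n \<le> 1 / 2\<close>, every mean is
      positive. Then \<open>Z n\<close> has its prescribed value, and the linearization error scaled
      by \<open>sqrt n\<close> is at most \<open>e\<close>.\<close>
    have sub: "?bad n \<subseteq> (\<Union>j\<in>J. {\<omega>\<in>space M. \<bar>m j n \<omega> - \<mu> j\<bar> \<ge> \<mu> j * r n})"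
      if n: "n > 0" "r n \<le> 1 / 2" for n
    proof
      fix \<omega> assume \<omega>: "\<omega> \<in> ?bad n"
      show "\<omega> \<in> (\<Union>j\<in>J. {\<omega>\<in>space M. \<bar>m j n \<omega> - \<mu> j\<bar> \<ge> \<mu> j * r n})"
      proof (rule ccontr)
        assume no: "\<not> ?thesis"
        have "\<omega> \<in> space M" using \<omega> by blast
        with no have small: "\<bar>m j n \<omega> - \<mu> j\<bar> < \<mu> j * r n" if "j \<in> J" for j
          unfolding not_le[symmetric] using that by blast
        have rel: "\<bar>m j n \<omega> / \<mu> j - 1\<bar> \<le> r n" if "j \<in> J" for j
        proof -
          have "m j n \<omega> / \<mu> j - 1 = (m j n \<omega> - \<mu> j) / \<mu> j"
            using \<mu>_pos[OF that] by (simp add: diff_divide_distrib)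
          then have "\<bar>m j n \<omega> / \<mu> j - 1\<bar> = \<bar>m j n \<omega> - \<mu> j\<bar> / \<mu> j"
            using \<mu>_pos[OF that] by (simp only: abs_divide abs_of_pos)
          then show ?thesis using small[OF that] \<mu>_pos[OF that]
            by (simp add: pos_divide_le_eq mult.commute less_imp_le)
        qed
        have m_pos: "m j n \<omega> > 0" if "j \<in> J" for j
        proof -
          have "m j n \<omega> / \<mu> j > 0" using rel[OF that] n(2) by linarith
          then show ?thesis using \<mu>_pos[OF that] by (simp add: zero_less_divide_iff)
        qed
        have "\<bar>(\<Sum>j\<in>J. c j * (ln (m j n \<omega>) - ln (\<mu> j))) - (\<Sum>j\<in>J. c j * (m j n \<omega> / \<mu> j - 1))\<bar>
            \<le> 2 * (r n)\<^sup>2 * A"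
          unfolding A_def by (rule sum_ln_linearization) (use \<mu>_pos rel m_pos n in auto)
        then have "sqrt (real n) * \<bar>(\<Sum>j\<in>J. c j * (ln (m j n \<omega>) - ln (\<mu> j))) - (\<Sum>j\<in>J. c j * (m j n \<omega> / \<mu> j - 1))\<bar>
            \<le> sqrt (real n) * (2 * (r n)\<^sup>2 * A)"
          by (rule mult_left_mono) simp
        also have "\<dots> \<le> e" by (rule r2[OF n(1)])
        finally have "\<bar>sqrt (real n) * (\<Sum>j\<in>J. c j * (ln (m j n \<omega>) - ln (\<mu> j))) - W n \<omega>\<bar> \<le> e"
          unfolding W_eq[OF n(1)] right_diff_distrib[symmetric] by (simp add: abs_mult)
        moreover have "Z n \<omega> = ereal (sqrt (real n) * (\<Sum>j\<in>J. c j * (ln (m j n \<omega>) - ln (\<mu> j))))"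
          unfolding m_def by (rule Z_eq) (use \<omega> n m_pos in \<open>auto simp: m_def\<close>)
        ultimately show False using \<omega> by auto
      qed
    qed
    have hoeffding: "prob {\<omega>\<in>space M. \<bar>m j n \<omega> - \<mu> j\<bar> \<ge> \<mu> j * r n} \<le>
        2 * exp (- ((\<mu> j * d)\<^sup>2 / 2) * sqrt (real n))" if j: "j \<in> J" and n: "n > 0" for j n
    proof -
      interpret H: Hoeffding_ineq_iid M "{..<n}" "\<lambda>k \<omega>. U j (D k \<omega>)" "\<lambda>\<omega>. U j (D 0 \<omega>)" "-1" 1 "\<mu> j"
      proof unfold_locales
        show "indep_vars (\<lambda>_. borel) (\<lambda>k \<omega>. U j (D k \<omega>)) {..<n}"
          by (rule indep_vars_compose2[OF indep_vars_subset[OF indep]]) (use U j in auto)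
        show "distr M borel (\<lambda>\<omega>. U j (D i \<omega>)) = distr M borel (\<lambda>\<omega>. U j (D 0 \<omega>))" for i
          by (rule ident'[OF U[OF j]])
        show "AE x in M. U j (D 0 x) \<in> {- 1..1}" using bound[OF j] by (auto simp: abs_le_iff minus_le_iff)
        show "\<mu> j \<equiv> expectation (\<lambda>\<omega>. U j (D 0 \<omega>))" using \<mu>[OF j] by simp
      qed (use UD[OF j] in auto)
      have "prob {\<omega>\<in>space M. \<bar>m j n \<omega> - \<mu> j\<bar> \<ge> \<mu> j * r n} \<le>
          2 * exp (- 2 * real n * (\<mu> j * r n)\<^sup>2 / (1 - (-1))\<^sup>2)"
        using H.Hoeffding_ineq_abs_ge'[of "\<mu> j * r n"] n \<mu>_pos[OF j] r0[of n]
        by (simp add: m_def lessThan_empty_iff)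
      \<comment> \<open>The values lie in an interval of length 2, whence the denominator 4; one
        factor \<open>sqrt n\<close> cancels against the square of \<open>r n\<close>.\<close>
      also have "- 2 * real n * (\<mu> j * r n)\<^sup>2 / (1 - (-1))\<^sup>2 = - ((\<mu> j * d)\<^sup>2 / 2) * sqrt (real n)"
        using n by (simp add: r_def power_mult_distrib power_divide field_simps
            flip: power2_eq_square)
      finally show ?thesis .
    qed
    have "(\<lambda>n. r n) \<longlonglongrightarrow> 0" unfolding r_def using d by real_asymp
    then have "\<forall>\<^sub>F n in sequentially. r n < 1 / 2" by (rule order_tendstoD) simp
    then have upper: "\<forall>\<^sub>F n in sequentially. prob (?bad n) \<le>
        (\<Sum>j\<in>J. 2 * exp (- ((\<mu> j * d)\<^sup>2 / 2) * sqrt (real n)))"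
      using eventually_gt_at_top[of 0]
    proof eventually_elim
      case (elim n)
      have "prob (?bad n) \<le> prob (\<Union>j\<in>J. {\<omega>\<in>space M. \<bar>m j n \<omega> - \<mu> j\<bar> \<ge> \<mu> j * r n})"
        using elim m_meas J by (intro finite_measure_mono sub) auto
      also have "\<dots> \<le> (\<Sum>j\<in>J. prob {\<omega>\<in>space M. \<bar>m j n \<omega> - \<mu> j\<bar> \<ge> \<mu> j * r n})"
        using m_meas J by (intro finite_measure_subadditive_finite) auto
      also have "\<dots> \<le> (\<Sum>j\<in>J. 2 * exp (- ((\<mu> j * d)\<^sup>2 / 2) * sqrt (real n)))"
        by (rule sum_mono) (rule hoeffding, use elim in auto)
      finally show ?case .
    qed
    have "(\<lambda>n. \<Sum>j\<in>J. 2 * exp (- ((\<mu> j * d)\<^sup>2 / 2) * sqrt (real n))) \<longlonglongrightarrow> (\<Sum>j\<in>J. 0)"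
    proof (rule tendsto_sum)
      fix j assume "j \<in> J"
      then have "(\<mu> j * d)\<^sup>2 / 2 > 0" using \<mu>_pos[of j] d by simp
      then show "(\<lambda>n. 2 * exp (- ((\<mu> j * d)\<^sup>2 / 2) * sqrt (real n))) \<longlonglongrightarrow> 0"
        by real_asymp
    qed
    then show "(\<lambda>n. prob (?bad n)) \<longlonglongrightarrow> 0"
      by (intro tendsto_sandwich[OF _ upper tendsto_const]) simp_all
  qed
qed

section \<open>Characteristic functions as expectations of cosines\<close>

lemma cf_eq_expectation_cos:
  assumes "prob_space N" and [measurable]: "A \<in> borel_measurable N"
  shows "cf N \<theta> A = (LINT \<omega>|N. cos (\<theta> * A \<omega>))"
proof -
  interpret prob_space N by fact
  have int: "integrable N (\<lambda>\<omega>. iexp (\<theta> * A \<omega>))"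
    by (rule integrable_const_bound[of _ 1]) (auto simp: norm_exp_i_times)
  have "char (distr N borel A) \<theta> = (CLINT \<omega>|N. iexp (\<theta> * A \<omega>))"
    unfolding char_def by (rule integral_distr) measurable
  then show ?thesis
    unfolding cf_def using integral_Re[OF int] by (simp add: Re_exp)
qed

text \<open>The half sum in the definition of \<open>C_cov\<close> is the product-to-sum formula for
  cosines, taken in expectation.\<close>

lemma C_cov_eq_covariance_cos:
  assumes N: "prob_space N" and [measurable]: "A \<in> borel_measurable N" "B \<in> borel_measurable N"
  shows "C_cov N \<theta> A B =
    (LINT \<omega>|N. cos (\<theta> * A \<omega>) * cos (\<theta> * B \<omega>)) - cf N \<theta> A * cf N \<theta> B"
proof -
  interpret prob_space N by fact
  have int: "integrable N (\<lambda>\<omega>. cos (\<theta> * f \<omega>))" if [measurable]: "f \<in> borel_measurable N" for f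
    by (rule integrable_const_bound[of _ 1]) auto
  have "(cf N \<theta> (\<lambda>\<omega>. A \<omega> + B \<omega>) + cf N \<theta> (\<lambda>\<omega>. A \<omega> - B \<omega>)) / 2 =
      (LINT \<omega>|N. (cos (\<theta> * (A \<omega> + B \<omega>)) + cos (\<theta> * (A \<omega> - B \<omega>))) / 2)"
    using int by (simp add: cf_eq_expectation_cos[OF N])
  also have "\<dots> = (LINT \<omega>|N. cos (\<theta> * A \<omega>) * cos (\<theta> * B \<omega>))"
    by (simp add: cos_times_cos distrib_left right_diff_distrib add.commute)
  finally show ?thesis by (simp add: C_cov_def)
qed

lemma C_cov_commute:
  assumes "prob_space N" "A \<in> borel_measurable N" "B \<in> borel_measurable N"
  shows "C_cov N \<theta> A B = C_cov N \<theta> B A"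
  using assms by (simp add: C_cov_eq_covariance_cos mult.commute)

text \<open>Passing to the adjoint turns the characteristic function of \<open>p \<bullet> V\<close>
  at \<open>\<theta>\<close> into that of the underlying strictly positive definite law at the
  vector \<open>adjoint T (\<theta> *\<^sub>R p)\<close>, where it is positive by definition of the
  class. This works for non-injective \<open>T\<close> too, so null components are covered.\<close>

lemma class_D_cf_pos:
  fixes V :: "'a \<Rightarrow> 'c::euclidean_space"
  assumes D: "class_D (distr N borel V)" and [measurable]: "V \<in> borel_measurable N"
  shows "0 < cf N \<theta> (\<lambda>\<omega>. p \<bullet> V \<omega>)"
proof -
  obtain \<nu> and T :: "'c \<Rightarrow> 'c" where \<nu>: "strictly_pd_law \<nu>" and T: "linear T"
    and eq: "distr N borel V = distr \<nu> borel T"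
    using D unfolding class_D_def by blast
  have [measurable_cong]: "sets \<nu> = sets borel"
    using \<nu> unfolding strictly_pd_law_def by (metis sets_density sets_lborel)
  have [measurable]: "T \<in> borel_measurable borel"
    using T by (intro borel_measurable_continuous_onI linear_continuous_on linear_linear[THEN iffD2])
  have "char (distr N borel (\<lambda>\<omega>. p \<bullet> V \<omega>)) \<theta> = (CLINT \<omega>|N. iexp (\<theta> * (p \<bullet> V \<omega>)))"
    unfolding char_def by (rule integral_distr) measurable
  also have "\<dots> = (CLINT z|distr N borel V. iexp (\<theta> * (p \<bullet> z)))"
    by (rule integral_distr[symmetric]) measurable
  also have "\<dots> = (CLINT x|\<nu>. iexp (\<theta> * (p \<bullet> T x)))"
    unfolding eq by (rule integral_distr) measurable
  also have "\<dots> = (CLINT x|\<nu>. iexp (adjoint T (\<theta> *\<^sub>R p) \<bullet> x))"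
    by (simp add: adjoint_clauses[OF T])
  finally show ?thesis
    using \<nu> unfolding strictly_pd_law_def cf_def by simp
qed

lemma Re_emp_cf: "Re (emp_cf \<theta> n a) = (\<Sum>k<n. cos (\<theta> * a k)) / real n"
  by (simp add: emp_cf_def Re_exp Re_divide_of_nat)

text \<open>The delta method with \<open>U p z = cos (\<theta> * (p \<bullet> z))\<close>. Indexing
  by coefficient vectors \<open>p\<close> treats all linear combinations of the two components at
  once, so that each of the three limit laws only requires a finite set \<open>J\<close> and weights
  \<open>c\<close>.\<close>

lemma conv_in_dist_emp_ln_cf:
  fixes X Y :: "'a \<Rightarrow> real" and Xs Ys :: "nat \<Rightarrow> 'b \<Rightarrow> real" and J :: "(real \<times> real) set"
    and c :: "real \<times> real \<Rightarrow> real" and Z :: "nat \<Rightarrow> 'b \<Rightarrow> ereal"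
  assumes N: "prob_space N" "X \<in> borel_measurable N" "Y \<in> borel_measurable N"
    and in_D: "class_D (distr N borel (\<lambda>\<omega>. (X \<omega>, Y \<omega>)))"
    and M: "prob_space M"
    and indep: "prob_space.indep_vars M (\<lambda>_. borel) (\<lambda>k \<omega>. (Xs k \<omega>, Ys k \<omega>)) UNIV"
    and ident: "\<And>k. distr M borel (\<lambda>\<omega>. (Xs k \<omega>, Ys k \<omega>)) = distr N borel (\<lambda>\<omega>. (X \<omega>, Y \<omega>))"
    and J: "finite J"
    and Z: "\<And>n. Z n \<in> borel_measurable M"
    and Z_eq: "\<And>n \<omega>. \<omega> \<in> space M \<Longrightarrow> 0 < n \<Longrightarrow>
      (\<And>p. p \<in> J \<Longrightarrow> 0 < Re (emp_cf \<theta> n (\<lambda>k. p \<bullet> (Xs k \<omega>, Ys k \<omega>)))) \<Longrightarrow>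
      Z n \<omega> = ereal (sqrt (real n) *
        (\<Sum>p\<in>J. c p * (ln (Re (emp_cf \<theta> n (\<lambda>k. p \<bullet> (Xs k \<omega>, Ys k \<omega>))))
          - ln (cf N \<theta> (\<lambda>\<omega>. p \<bullet> (X \<omega>, Y \<omega>))))))"
  shows "conv_in_dist_ereal M Z (gaussian 0 (\<Sum>p\<in>J. \<Sum>q\<in>J. c p * c q *
    C_cov N \<theta> (\<lambda>\<omega>. p \<bullet> (X \<omega>, Y \<omega>)) (\<lambda>\<omega>. q \<bullet> (X \<omega>, Y \<omega>)) /
    (cf N \<theta> (\<lambda>\<omega>. p \<bullet> (X \<omega>, Y \<omega>)) * cf N \<theta> (\<lambda>\<omega>. q \<bullet> (X \<omega>, Y \<omega>)))))"
proof -
  interpret M: prob_space M by fact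
  note [measurable] = N(2,3)
  define D where "D k \<omega> = (Xs k \<omega>, Ys k \<omega>)" for k \<omega>
  define U :: "real \<times> real \<Rightarrow> real \<times> real \<Rightarrow> real" where "U p z = cos (\<theta> * (p \<bullet> z))" for p z
  have D[measurable]: "D k \<in> borel_measurable M" for k
    using indep unfolding M.indep_vars_def D_def by blast
  have U[measurable]: "U p \<in> borel_measurable borel" for p unfolding U_def[abs_def] by measurable
  have XY[measurable]: "(\<lambda>\<omega>. (X \<omega>, Y \<omega>)) \<in> borel_measurable N" by measurable
  have lin[measurable]: "(\<lambda>\<omega>. p \<bullet> (X \<omega>, Y \<omega>)) \<in> borel_measurable N" for p by measurable
  \<comment> \<open>The sample lives on \<open>M\<close> and the pair that defines the theoretical
    quantities on \<open>N\<close>; only their common law relates the two.\<close>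
  have transfer: "M.expectation (\<lambda>\<omega>. h (D 0 \<omega>)) = (LINT \<omega>|N. h (X \<omega>, Y \<omega>))"
    if [measurable]: "h \<in> borel_measurable borel" for h :: "real \<times> real \<Rightarrow> real"
  proof -
    have "M.expectation (\<lambda>\<omega>. h (D 0 \<omega>)) = integral\<^sup>L (distr M borel (D 0)) h"
      by (rule integral_distr[symmetric]) measurable
    also have "\<dots> = integral\<^sup>L (distr N borel (\<lambda>\<omega>. (X \<omega>, Y \<omega>))) h"
      using ident[of 0] unfolding D_def[abs_def] by simp
    also have "\<dots> = (LINT \<omega>|N. h (X \<omega>, Y \<omega>))" by (rule integral_distr) measurable
    finally show ?thesis .
  qed
  have emp: "Re (emp_cf \<theta> n (\<lambda>k. p \<bullet> (Xs k \<omega>, Ys k \<omega>))) = (\<Sum>k<n. U p (D k \<omega>)) / real n" for n p \<omega>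
    by (simp add: Re_emp_cf U_def D_def)
  have cov: "C_cov N \<theta> (\<lambda>\<omega>. p \<bullet> (X \<omega>, Y \<omega>)) (\<lambda>\<omega>. q \<bullet> (X \<omega>, Y \<omega>)) =
      M.expectation (\<lambda>\<omega>. U p (D 0 \<omega>) * U q (D 0 \<omega>)) -
      cf N \<theta> (\<lambda>\<omega>. p \<bullet> (X \<omega>, Y \<omega>)) * cf N \<theta> (\<lambda>\<omega>. q \<bullet> (X \<omega>, Y \<omega>))" for p q
    by (subst transfer[of "\<lambda>z. U p z * U q z"]) (auto simp: C_cov_eq_covariance_cos[OF N(1) lin lin] U_def)
  show ?thesis
    unfolding cov
  proof (rule M.delta_method_ln[OF J])
    show "M.indep_vars (\<lambda>_. borel) D UNIV" using indep unfolding D_def .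
    show "distr M borel (D k) = distr M borel (D 0)" for k
      using ident[of k] ident[of 0] unfolding D_def[abs_def] by simp
    show "cf N \<theta> (\<lambda>\<omega>. p \<bullet> (X \<omega>, Y \<omega>)) = M.expectation (\<lambda>\<omega>. U p (D 0 \<omega>))" for p
      by (subst transfer) (auto simp: cf_eq_expectation_cos[OF N(1) lin] U_def)
    show "0 < cf N \<theta> (\<lambda>\<omega>. p \<bullet> (X \<omega>, Y \<omega>))" for p
      by (rule class_D_cf_pos[OF in_D XY])
    show "Z n \<omega> = ereal (sqrt (real n) * (\<Sum>p\<in>J. c p * (ln ((\<Sum>k<n. U p (D k \<omega>)) / real n) -
        ln (cf N \<theta> (\<lambda>\<omega>. p \<bullet> (X \<omega>, Y \<omega>))))))"
      if "\<omega> \<in> space M" "0 < n" "\<And>p. p \<in> J \<Longrightarrow> 0 < (\<Sum>k<n. U p (D k \<omega>)) / real n" for n \<omega>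
      using that unfolding emp[symmetric] by (rule Z_eq)
  qed (use Z in \<open>auto simp: U_def\<close>)
qed

section \<open>Evaluation of the variances and the three limit laws\<close>

lemma quadratic_form_doubleton:
  fixes c f :: "'j \<Rightarrow> real" and K :: "'j \<Rightarrow> 'j \<Rightarrow> real"
  assumes "a \<noteq> b" "K b a = K a b"
  shows "(\<Sum>p\<in>{a, b}. \<Sum>q\<in>{a, b}. c p * c q * K p q / (f p * f q)) =
    (c a)\<^sup>2 * K a a / (f a)\<^sup>2 + (c b)\<^sup>2 * K b b / (f b)\<^sup>2 + 2 * (c a * c b) * K a b / (f a * f b)"
  using assms by (simp add: power2_eq_square mult_ac)

lemma quadratic_form_tripleton:
  fixes c f :: "'j \<Rightarrow> real" and K :: "'j \<Rightarrow> 'j \<Rightarrow> real"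
  assumes "a \<noteq> b" "a \<noteq> d" "b \<noteq> d" "K b a = K a b" "K d a = K a d" "K d b = K b d"
  shows "(\<Sum>p\<in>{a, b, d}. \<Sum>q\<in>{a, b, d}. c p * c q * K p q / (f p * f q)) =
    (c a)\<^sup>2 * K a a / (f a)\<^sup>2 + (c b)\<^sup>2 * K b b / (f b)\<^sup>2 + (c d)\<^sup>2 * K d d / (f d)\<^sup>2
    + 2 * (c a * c b) * K a b / (f a * f b) + 2 * (c a * c d) * K a d / (f a * f d)
    + 2 * (c b * c d) * K b d / (f b * f d)"
  using assms by (simp add: power2_eq_square mult_ac)

lemma emp_lcf_eq_ereal:
  "0 < Re (emp_cf \<theta> n a) \<Longrightarrow> emp_lcf \<theta> n a = ereal (- (2 / \<theta>\<^sup>2) * ln (Re (emp_cf \<theta> n a)))"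
  by (simp add: emp_lcf_def)

theorem proposition18:
  fixes N :: "'a measure" and M :: "'b measure"
    and X Y :: "'a \<Rightarrow> real"
    and Xs Ys :: "nat \<Rightarrow> 'b \<Rightarrow> real"
    and S :: "nat \<Rightarrow> 'b \<Rightarrow> real"
    and C :: "real \<Rightarrow> nat \<Rightarrow> 'b \<Rightarrow> real"
    and \<theta> :: real
  assumes theta: "\<theta> \<noteq> 0"
    and N: "prob_space N" "X \<in> borel_measurable N" "Y \<in> borel_measurable N"
    and in_D: "class_D (distr N borel (\<lambda>\<omega>. (X \<omega>, Y \<omega>)))"
    and M: "prob_space M"
    and indep: "prob_space.indep_vars M (\<lambda>_. borel) (\<lambda>k \<omega>. (Xs k \<omega>, Ys k \<omega>)) UNIV"
    and ident: "\<And>k. distr M borel (\<lambda>\<omega>. (Xs k \<omega>, Ys k \<omega>)) = distr N borel (\<lambda>\<omega>. (X \<omega>, Y \<omega>))"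
    \<comment> \<open>real-valued versions of the empirical codifferences, with arbitrary values where one of
      the empirical lcfs involved is infinite\<close>
    and S_meas: "\<And>n. S n \<in> borel_measurable M"
    and S_eq: "\<And>n \<omega>. \<omega> \<in> space M \<Longrightarrow>
        emp_lcf \<theta> n (\<lambda>k. Xs k \<omega> + Ys k \<omega>) \<noteq> \<infinity> \<Longrightarrow>
        emp_lcf \<theta> n (\<lambda>k. Xs k \<omega> - Ys k \<omega>) \<noteq> \<infinity> \<Longrightarrow>
        ereal (S n \<omega>) = emp_codiff_s \<theta> n (\<lambda>k. Xs k \<omega>) (\<lambda>k. Ys k \<omega>)"
    and C_meas: "\<And>\<sigma> n. \<sigma> \<in> {1, -1} \<Longrightarrow> C \<sigma> n \<in> borel_measurable M"
    and C_eq: "\<And>\<sigma> n \<omega>. \<sigma> \<in> {1, -1} \<Longrightarrow> \<omega> \<in> space M \<Longrightarrow>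
        emp_lcf \<theta> n (\<lambda>k. Xs k \<omega>) \<noteq> \<infinity> \<Longrightarrow>
        emp_lcf \<theta> n (\<lambda>k. Ys k \<omega>) \<noteq> \<infinity> \<Longrightarrow>
        emp_lcf \<theta> n (\<lambda>k. Xs k \<omega> - \<sigma> * Ys k \<omega>) \<noteq> \<infinity> \<Longrightarrow>
        ereal (C \<sigma> n \<omega>) = emp_codiff_c \<sigma> \<theta> n (\<lambda>k. Xs k \<omega>) (\<lambda>k. Ys k \<omega>)"
  shows
    "conv_in_dist_ereal M
       (\<lambda>n \<omega>. ereal (sqrt (real n)) * (emp_lcf \<theta> n (\<lambda>k. Xs k \<omega>) - ereal (lcf N \<theta> X)))
       (gaussian 0 (4 / \<theta> ^ 4 * (C_cov N \<theta> X X / (cf N \<theta> X)\<^sup>2)))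
     \<and>
     (let P = (\<lambda>\<omega>. X \<omega> + Y \<omega>); Q = (\<lambda>\<omega>. X \<omega> - Y \<omega>) in
     weak_conv_m
       (\<lambda>n. distr M borel (\<lambda>\<omega>. sqrt (real n) * (S n \<omega> - codiff_s N \<theta> X Y)))
       (gaussian 0 (1 / (4 * \<theta> ^ 4) *
          (C_cov N \<theta> P P / (cf N \<theta> P)\<^sup>2 + C_cov N \<theta> Q Q / (cf N \<theta> Q)\<^sup>2
           - 2 * C_cov N \<theta> P Q / (cf N \<theta> P * cf N \<theta> Q)))))
     \<and>
     (\<forall>\<sigma>\<in>{1, -1}. let Z = (\<lambda>\<omega>. X \<omega> - \<sigma> * Y \<omega>) in
     weak_conv_m
       (\<lambda>n. distr M borel (\<lambda>\<omega>. sqrt (real n) * (C \<sigma> n \<omega> - codiff_c N \<sigma> \<theta> X Y)))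
       (gaussian 0 (1 / \<theta> ^ 4 *
          (C_cov N \<theta> X X / (cf N \<theta> X)\<^sup>2 + C_cov N \<theta> Y Y / (cf N \<theta> Y)\<^sup>2
           + C_cov N \<theta> Z Z / (cf N \<theta> Z)\<^sup>2
           + 2 * C_cov N \<theta> X Y / (cf N \<theta> X * cf N \<theta> Y)
           - 2 * C_cov N \<theta> X Z / (cf N \<theta> X * cf N \<theta> Z)
           - 2 * C_cov N \<theta> Y Z / (cf N \<theta> Y * cf N \<theta> Z)))))"
proof -
  interpret M: prob_space M by fact
  note [measurable] = N(2,3) S_meas
  have "(\<lambda>\<omega>. (Xs k \<omega>, Ys k \<omega>)) \<in> borel_measurable M" for k
    using indep unfolding M.indep_vars_def by blast
  then have "(\<lambda>\<omega>. fst (Xs k \<omega>, Ys k \<omega>)) \<in> borel_measurable M" for k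
    by (rule borel_measurable_continuous_on[rotated]) (intro continuous_intros)
  then have Xs[measurable]: "Xs k \<in> borel_measurable M" for k by simp
  note conv = conv_in_dist_emp_ln_cf[OF N in_D M indep ident]
  have comm: "C_cov N \<theta> A B = C_cov N \<theta> B A"
    if "A \<in> borel_measurable N" "B \<in> borel_measurable N" for A B
    using N(1) that by (rule C_cov_commute)
  \<comment> \<open>One coefficient vector \<open>(1, 0)\<close> with weight
    \<open>- 2 / \<theta>\<^sup>2\<close>, whose square yields the factor
    \<open>4 / \<theta> ^ 4\<close>.\<close>
  let ?Z = "\<lambda>n \<omega>. ereal (sqrt (real n)) * (emp_lcf \<theta> n (\<lambda>k. Xs k \<omega>) - ereal (lcf N \<theta> X))"
  have "conv_in_dist_ereal M ?Z (gaussian 0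
      (\<Sum>p\<in>{(1, 0)}. \<Sum>q\<in>{(1, 0)}. (- 2 / \<theta>\<^sup>2) * (- 2 / \<theta>\<^sup>2) *
        C_cov N \<theta> (\<lambda>\<omega>. p \<bullet> (X \<omega>, Y \<omega>)) (\<lambda>\<omega>. q \<bullet> (X \<omega>, Y \<omega>)) /
        (cf N \<theta> (\<lambda>\<omega>. p \<bullet> (X \<omega>, Y \<omega>)) * cf N \<theta> (\<lambda>\<omega>. q \<bullet> (X \<omega>, Y \<omega>)))))"
  proof (rule conv)
    show "?Z n \<in> borel_measurable M" for n
      unfolding emp_lcf_def Re_emp_cf by measurable
    fix n \<omega>
    assume "\<And>p::real \<times> real. p \<in> {(1, 0)} \<Longrightarrow> 0 < Re (emp_cf \<theta> n (\<lambda>k. p \<bullet> (Xs k \<omega>, Ys k \<omega>)))"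
    from this[of "(1, 0)"] show "?Z n \<omega> = ereal (sqrt (real n) *
        (\<Sum>p\<in>{(1, 0)}. - 2 / \<theta>\<^sup>2 * (ln (Re (emp_cf \<theta> n (\<lambda>k. p \<bullet> (Xs k \<omega>, Ys k \<omega>))))
          - ln (cf N \<theta> (\<lambda>\<omega>. p \<bullet> (X \<omega>, Y \<omega>))))))"
      by (simp add: emp_lcf_eq_ereal lcf_def algebra_simps)
  qed simp
  then have lcf: "conv_in_dist_ereal M ?Z (gaussian 0 (4 / \<theta> ^ 4 * (C_cov N \<theta> X X / (cf N \<theta> X)\<^sup>2)))"
    by (simp add: power2_eq_square power4_eq_xxxx mult.assoc)

  let ?P = "\<lambda>\<omega>. X \<omega> + Y \<omega>" and ?Q = "\<lambda>\<omega>. X \<omega> - Y \<omega>"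
  let ?R = "\<lambda>n \<omega>. sqrt (real n) * (S n \<omega> - codiff_s N \<theta> X Y)"
  \<comment> \<open>The weights are the factor \<open>- 2 / \<theta>\<^sup>2\<close> of the lcf
    times 1/4 for the sum \<open>(1, 1)\<close> and times -1/4 for the difference
    \<open>(1, -1)\<close>.\<close>
  define c :: "real \<times> real \<Rightarrow> real" where "c = (\<lambda>p. if p = (1, 1) then - 1 / (2 * \<theta>\<^sup>2) else 1 / (2 * \<theta>\<^sup>2))"
  have "conv_in_dist_ereal M (\<lambda>n \<omega>. ereal (?R n \<omega>)) (gaussian 0
      (\<Sum>p\<in>{(1, 1), (1, -1)}. \<Sum>q\<in>{(1, 1), (1, -1)}. c p * c q *
        C_cov N \<theta> (\<lambda>\<omega>. p \<bullet> (X \<omega>, Y \<omega>)) (\<lambda>\<omega>. q \<bullet> (X \<omega>, Y \<omega>)) /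
        (cf N \<theta> (\<lambda>\<omega>. p \<bullet> (X \<omega>, Y \<omega>)) * cf N \<theta> (\<lambda>\<omega>. q \<bullet> (X \<omega>, Y \<omega>)))))"
  proof (rule conv)
    fix n \<omega>
    assume \<omega>: "\<omega> \<in> space M" and
      pos: "\<And>p::real \<times> real. p \<in> {(1, 1), (1, -1)} \<Longrightarrow> 0 < Re (emp_cf \<theta> n (\<lambda>k. p \<bullet> (Xs k \<omega>, Ys k \<omega>)))"
    have pos': "0 < Re (emp_cf \<theta> n (\<lambda>k. Xs k \<omega> + Ys k \<omega>))" "0 < Re (emp_cf \<theta> n (\<lambda>k. Xs k \<omega> - Ys k \<omega>))"
      using pos[of "(1, 1)"] pos[of "(1, -1)"] by simp_all
    \<comment> \<open>Positive real parts make both empirical lcfs finite, so here the value of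
      \<open>S n\<close> is not arbitrary.\<close>
    have "ereal (S n \<omega>) = emp_codiff_s \<theta> n (\<lambda>k. Xs k \<omega>) (\<lambda>k. Ys k \<omega>)"
      using \<omega> by (rule S_eq) (simp_all add: emp_lcf_eq_ereal pos')
    then have S: "S n \<omega> = (- (2 / \<theta>\<^sup>2) * ln (Re (emp_cf \<theta> n (\<lambda>k. Xs k \<omega> + Ys k \<omega>)))
        - (- (2 / \<theta>\<^sup>2) * ln (Re (emp_cf \<theta> n (\<lambda>k. Xs k \<omega> - Ys k \<omega>))))) / 4"
      unfolding emp_codiff_s_def pos'[THEN emp_lcf_eq_ereal] by simp
    have "S n \<omega> - codiff_s N \<theta> X Y =
        c (1, 1) * (ln (Re (emp_cf \<theta> n (\<lambda>k. Xs k \<omega> + Ys k \<omega>))) - ln (cf N \<theta> ?P))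
        + c (1, -1) * (ln (Re (emp_cf \<theta> n (\<lambda>k. Xs k \<omega> - Ys k \<omega>))) - ln (cf N \<theta> ?Q))"
      unfolding S codiff_s_def lcf_def c_def using theta by (simp add: field_simps)
    then show "ereal (?R n \<omega>) = ereal (sqrt (real n) *
        (\<Sum>p\<in>{(1, 1), (1, -1)}. c p * (ln (Re (emp_cf \<theta> n (\<lambda>k. p \<bullet> (Xs k \<omega>, Ys k \<omega>))))
          - ln (cf N \<theta> (\<lambda>\<omega>. p \<bullet> (X \<omega>, Y \<omega>))))))"
      by simp
  qed simp_all
  moreover have "(\<Sum>p\<in>{(1, 1), (1, -1)}. \<Sum>q\<in>{(1, 1), (1, -1)}. c p * c q *
        C_cov N \<theta> (\<lambda>\<omega>. p \<bullet> (X \<omega>, Y \<omega>)) (\<lambda>\<omega>. q \<bullet> (X \<omega>, Y \<omega>)) /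
        (cf N \<theta> (\<lambda>\<omega>. p \<bullet> (X \<omega>, Y \<omega>)) * cf N \<theta> (\<lambda>\<omega>. q \<bullet> (X \<omega>, Y \<omega>)))) =
      1 / (4 * \<theta> ^ 4) *
          (C_cov N \<theta> ?P ?P / (cf N \<theta> ?P)\<^sup>2 + C_cov N \<theta> ?Q ?Q / (cf N \<theta> ?Q)\<^sup>2
           - 2 * C_cov N \<theta> ?P ?Q / (cf N \<theta> ?P * cf N \<theta> ?Q))"
  proof -
    define k where "k = 1 / (4 * \<theta> ^ 4)"
    \<comment> \<open>The opposite signs of the two weights produce the minus sign of the cross
      term; its factor 2 comes from the symmetry of \<open>C_cov\<close>.\<close>
    have coeffs: "(c (1, 1))\<^sup>2 = k" "(c (1, -1))\<^sup>2 = k" "c (1, 1) * c (1, -1) = - k"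
      by (simp_all add: c_def k_def power2_eq_square power4_eq_xxxx)
    show ?thesis
      unfolding k_def[symmetric]
      by (subst quadratic_form_doubleton)
         (use comm[of ?Q ?P] in \<open>simp_all add: coeffs distrib_left right_diff_distrib\<close>)
  qed
  ultimately have s: "weak_conv_m (\<lambda>n. distr M borel (?R n)) (gaussian 0 (1 / (4 * \<theta> ^ 4) *
          (C_cov N \<theta> ?P ?P / (cf N \<theta> ?P)\<^sup>2 + C_cov N \<theta> ?Q ?Q / (cf N \<theta> ?Q)\<^sup>2
           - 2 * C_cov N \<theta> ?P ?Q / (cf N \<theta> ?P * cf N \<theta> ?Q))))"
    by (subst (asm) conv_in_dist_ereal_real) simp_all

  have "weak_conv_m (\<lambda>n. distr M borel (\<lambda>\<omega>. sqrt (real n) * (C \<sigma> n \<omega> - codiff_c N \<sigma> \<theta> X Y)))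
       (gaussian 0 (1 / \<theta> ^ 4 *
          (C_cov N \<theta> X X / (cf N \<theta> X)\<^sup>2 + C_cov N \<theta> Y Y / (cf N \<theta> Y)\<^sup>2
           + C_cov N \<theta> Z Z / (cf N \<theta> Z)\<^sup>2
           + 2 * C_cov N \<theta> X Y / (cf N \<theta> X * cf N \<theta> Y)
           - 2 * C_cov N \<theta> X Z / (cf N \<theta> X * cf N \<theta> Z)
           - 2 * C_cov N \<theta> Y Z / (cf N \<theta> Y * cf N \<theta> Z))))"
    if \<sigma>: "\<sigma> \<in> {1, -1}" and Z: "Z = (\<lambda>\<omega>. X \<omega> - \<sigma> * Y \<omega>)" for \<sigma> Z
  proof -
    let ?R = "\<lambda>n \<omega>. sqrt (real n) * (C \<sigma> n \<omega> - codiff_c N \<sigma> \<theta> X Y)"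
    let ?J = "{(1, 0), (0, 1), (1, - \<sigma>)} :: (real \<times> real) set"
    note [measurable] = C_meas[OF \<sigma>]
    have Z_meas: "Z \<in> borel_measurable N" unfolding Z by measurable
    \<comment> \<open>That \<open>\<sigma>\<close> is nonzero keeps \<open>(1, - \<sigma>)\<close>
      distinct from \<open>(1, 0)\<close>, so the sum over the set has three terms. That its square
      is 1 removes the sign from the variance, which gives both codifferences the same form of
      limit.\<close>
    have \<sigma>0: "\<sigma> \<noteq> 0" and \<sigma>2: "\<sigma> * \<sigma> = 1" using \<sigma> by auto
    \<comment> \<open>The prefactor \<open>\<sigma> / 2\<close> times
      \<open>- 2 / \<theta>\<^sup>2\<close> is the weight of the two components; the combination
      \<open>(1, - \<sigma>)\<close> is subtracted and has the opposite weight.\<close>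
    define c :: "real \<times> real \<Rightarrow> real" where "c = (\<lambda>p. if p = (1, - \<sigma>) then \<sigma> / \<theta>\<^sup>2 else - \<sigma> / \<theta>\<^sup>2)"
    have "conv_in_dist_ereal M (\<lambda>n \<omega>. ereal (?R n \<omega>)) (gaussian 0
      (\<Sum>p\<in>?J. \<Sum>q\<in>?J. c p * c q *
        C_cov N \<theta> (\<lambda>\<omega>. p \<bullet> (X \<omega>, Y \<omega>)) (\<lambda>\<omega>. q \<bullet> (X \<omega>, Y \<omega>)) /
        (cf N \<theta> (\<lambda>\<omega>. p \<bullet> (X \<omega>, Y \<omega>)) * cf N \<theta> (\<lambda>\<omega>. q \<bullet> (X \<omega>, Y \<omega>)))))"
    proof (rule conv)
      fix n \<omega>
      assume \<omega>: "\<omega> \<in> space M" and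
        pos: "\<And>p. p \<in> ?J \<Longrightarrow> 0 < Re (emp_cf \<theta> n (\<lambda>k. p \<bullet> (Xs k \<omega>, Ys k \<omega>)))"
      have pos': "0 < Re (emp_cf \<theta> n (\<lambda>k. Xs k \<omega>))" "0 < Re (emp_cf \<theta> n (\<lambda>k. Ys k \<omega>))"
        "0 < Re (emp_cf \<theta> n (\<lambda>k. Xs k \<omega> - \<sigma> * Ys k \<omega>))"
        using pos[of "(1, 0)"] pos[of "(0, 1)"] pos[of "(1, - \<sigma>)"] by simp_all
      have "ereal (C \<sigma> n \<omega>) = emp_codiff_c \<sigma> \<theta> n (\<lambda>k. Xs k \<omega>) (\<lambda>k. Ys k \<omega>)"
        using \<sigma> \<omega> by (rule C_eq) (simp_all add: emp_lcf_eq_ereal pos')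
      then have C: "C \<sigma> n \<omega> = \<sigma> / 2 * (- (2 / \<theta>\<^sup>2) * ln (Re (emp_cf \<theta> n (\<lambda>k. Xs k \<omega>)))
          + - (2 / \<theta>\<^sup>2) * ln (Re (emp_cf \<theta> n (\<lambda>k. Ys k \<omega>)))
          - (- (2 / \<theta>\<^sup>2) * ln (Re (emp_cf \<theta> n (\<lambda>k. Xs k \<omega> - \<sigma> * Ys k \<omega>)))))"
        unfolding emp_codiff_c_def pos'[THEN emp_lcf_eq_ereal] by simp
      have "C \<sigma> n \<omega> - codiff_c N \<sigma> \<theta> X Y =
          c (1, 0) * (ln (Re (emp_cf \<theta> n (\<lambda>k. Xs k \<omega>))) - ln (cf N \<theta> X))
          + (c (0, 1) * (ln (Re (emp_cf \<theta> n (\<lambda>k. Ys k \<omega>))) - ln (cf N \<theta> Y))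
          + c (1, - \<sigma>) * (ln (Re (emp_cf \<theta> n (\<lambda>k. Xs k \<omega> - \<sigma> * Ys k \<omega>))) - ln (cf N \<theta> Z)))"
      proof -
        define k where "k = 1 / \<theta>\<^sup>2"
        have k: "2 / \<theta>\<^sup>2 = 2 * k" "c (1, 0) = - \<sigma> * k" "c (0, 1) = - \<sigma> * k" "c (1, - \<sigma>) = \<sigma> * k"
          using \<sigma>0 by (simp_all add: k_def c_def)
        show ?thesis
          unfolding C codiff_c_def lcf_def k Z[symmetric] by (simp add: field_simps)
      qed
      then show "ereal (?R n \<omega>) = ereal (sqrt (real n) *
          (\<Sum>p\<in>?J. c p * (ln (Re (emp_cf \<theta> n (\<lambda>k. p \<bullet> (Xs k \<omega>, Ys k \<omega>))))
            - ln (cf N \<theta> (\<lambda>\<omega>. p \<bullet> (X \<omega>, Y \<omega>))))))"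
        using \<sigma>0 by (simp add: Z)
    qed simp_all
    moreover have "(\<Sum>p\<in>?J. \<Sum>q\<in>?J. c p * c q *
        C_cov N \<theta> (\<lambda>\<omega>. p \<bullet> (X \<omega>, Y \<omega>)) (\<lambda>\<omega>. q \<bullet> (X \<omega>, Y \<omega>)) /
        (cf N \<theta> (\<lambda>\<omega>. p \<bullet> (X \<omega>, Y \<omega>)) * cf N \<theta> (\<lambda>\<omega>. q \<bullet> (X \<omega>, Y \<omega>)))) =
      1 / \<theta> ^ 4 *
          (C_cov N \<theta> X X / (cf N \<theta> X)\<^sup>2 + C_cov N \<theta> Y Y / (cf N \<theta> Y)\<^sup>2
           + C_cov N \<theta> Z Z / (cf N \<theta> Z)\<^sup>2
           + 2 * C_cov N \<theta> X Y / (cf N \<theta> X * cf N \<theta> Y)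
           - 2 * C_cov N \<theta> X Z / (cf N \<theta> X * cf N \<theta> Z)
           - 2 * C_cov N \<theta> Y Z / (cf N \<theta> Y * cf N \<theta> Z))"
    proof -
      define k where "k = 1 / \<theta> ^ 4"
      have coeffs: "(c (1, 0))\<^sup>2 = k" "(c (0, 1))\<^sup>2 = k" "(c (1, - \<sigma>))\<^sup>2 = k"
        "c (1, 0) * c (0, 1) = k" "c (1, 0) * c (1, - \<sigma>) = - k" "c (0, 1) * c (1, - \<sigma>) = - k"
        using \<sigma>0 \<sigma>2 by (simp_all add: c_def k_def power2_eq_square power4_eq_xxxx)
      show ?thesis
        unfolding k_def[symmetric]
        by (subst quadratic_form_tripleton)
           (use \<sigma>0 comm[OF N(3,2)] comm[OF Z_meas N(2)] comm[OF Z_meas N(3)]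
            in \<open>simp_all add: coeffs distrib_left right_diff_distrib mult_ac Z[symmetric]\<close>)
    qed
    ultimately show ?thesis
      by (subst (asm) conv_in_dist_ereal_real) simp_all
  qed
  with lcf s show ?thesis by (simp add: Let_def)
qed

end
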